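(* Fix four positive masses $m_1,m_2,m_3,m_4>0$ in the Newtonian four-body problem. For each cyclic ordering of the four masses on a circle, there is at most one co-circular central configuration of the four bodies with that cyclic ordering, counted up to equivalence (two configurations $\mathbf{q},\mathbf{q}'$ being equivalent if $\mathbf{q}_i'=kR\mathbf{q}_i$ for all $i$, for some nonzero constant $k\in\mathbb{R}$ and some orthogonal matrix $R$).
   Context: Bodies with masses $m_i>0$ are at positions $\mathbf{q}_i\in\mathbb{R}^d$, $i=1,\dots,4$, with center of mass $\frac1M\sum m_i\mathbf{q}_i=0$, where $M=m_1+\dots+m_4$; $r_{ij}=\|\mathbf{q}_i-\mathbf{q}_j\|$. A central configuration is a configuration $\mathbf{q}$ (with distinct positions) for which there exists $\lambda\in\mathbb{R}$ with $\lambda m_i\mathbf{q}_i=\sum_{j\neq i}\frac{m_im_j(\mathbf{q}_j-\mathbf{q}_i)}{r_{ij}^3}$ for $i=1,\dots,4$. A configuration is co-circular if the four bodies lie on a common circle; the cyclic ordering is the order in which the masses appear around that circle. *)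

theory Defs
  imports "HOL-Analysis.Analysis"
begin

text \<open>Bodies are indexed by 0,1,2,3 (paper: 1..4). Positions live in real^'d.\<close>

definition central_config :: "(nat \<Rightarrow> real) \<Rightarrow> (nat \<Rightarrow> real^'d) \<Rightarrow> bool" where
  "central_config m q \<longleftrightarrow>
     (\<forall>i<4. \<forall>j<4. i \<noteq> j \<longrightarrow> q i \<noteq> q j) \<and>
     (\<Sum>i<4. m i *\<^sub>R q i) = 0 \<and>
     (\<exists>lam::real. \<forall>i<4.
        (lam * m i) *\<^sub>R q i =
        (\<Sum>j\<in>{..<4} - {i}. (m i * m j / (dist (q i) (q j)) ^ 3) *\<^sub>R (q j - q i)))"

text \<open>The four bodies lie on a common circle (centre c, radius r, in the plane spanned by
  the orthonormal vectors u, v) and, going around that circle, they appear in the order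
  \<sigma> 0, \<sigma> 1, \<sigma> 2, \<sigma> 3.  Since v may be replaced by -v, the orientation is irrelevant.\<close>
definition cocircular_with_order :: "(nat \<Rightarrow> nat) \<Rightarrow> (nat \<Rightarrow> real^'d) \<Rightarrow> bool" where
  "cocircular_with_order \<sigma> q \<longleftrightarrow>
     (\<exists>c u v (r::real) (\<theta>::nat \<Rightarrow> real).
        r > 0 \<and> u \<bullet> u = 1 \<and> v \<bullet> v = 1 \<and> u \<bullet> v = 0 \<and>
        (\<forall>i<4. q i = c + r *\<^sub>R (cos (\<theta> i) *\<^sub>R u + sin (\<theta> i) *\<^sub>R v)) \<and>
        \<theta> (\<sigma> 0) < \<theta> (\<sigma> 1) \<and> \<theta> (\<sigma> 1) < \<theta> (\<sigma> 2) \<and>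
        \<theta> (\<sigma> 2) < \<theta> (\<sigma> 3) \<and> \<theta> (\<sigma> 3) < \<theta> (\<sigma> 0) + 2 * pi)"

definition equivalent_config :: "(nat \<Rightarrow> real^'d) \<Rightarrow> (nat \<Rightarrow> real^'d) \<Rightarrow> bool" where
  "equivalent_config q q' \<longleftrightarrow>
     (\<exists>(k::real) (R::real^'d^'d). k \<noteq> 0 \<and> orthogonal_matrix R \<and>
        (\<forall>i<4. q' i = k *\<^sub>R (R *v q i)))"

end

theory Submission
  imports Defs
begin

text \<open>
  In the logarithms of the mutual distances, the sum of \<open>m\<^sub>i m\<^sub>j (1/r\<^sub>i\<^sub>j + r\<^sub>i\<^sub>j\<^sup>2/2)\<close>
  is strictly convex, and Ptolemy's relation \<open>r\<^sub>0\<^sub>2 r\<^sub>1\<^sub>3 = r\<^sub>0\<^sub>1 r\<^sub>2\<^sub>3 + r\<^sub>0\<^sub>3 r\<^sub>1\<^sub>2\<close>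
  is the boundary of a convex set, because the logarithm of a sum of exponentials is convex.
  After rescaling, the distances of a co-circular central configuration satisfy the
  stationarity equations of this sum under Ptolemy's constraint, and the multiplier
  has the sign of a minimum over the convex set. So the distances are the unique minimizer. Finally,
  the distances determine a centered configuration up to an orthogonal map.
\<close>

section \<open>Rigidity: distances determine a centered configuration up to an orthogonal
  map\<close>

lemma orthogonal_transformation_reflection:
  fixes n :: "'a::euclidean_space"
  shows "orthogonal_transformation (\<lambda>x. x - (2 * (x \<bullet> n) / (n \<bullet> n)) *\<^sub>R n)"
proof (cases "n = 0")
  case True
  then show ?thesis by simp
next
  case False
  let ?h = "\<lambda>x. x - (2 * (x \<bullet> n) / (n \<bullet> n)) *\<^sub>R n"
  have "linear ?h"
    by (rule linearI) (auto simp: algebra_simps inner_simps add_divide_distrib)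
  moreover have "?h x \<bullet> ?h y = x \<bullet> y" for x y
    using False by (simp add: inner_simps inner_commute field_simps)
  ultimately show ?thesis
    unfolding orthogonal_transformation_def by blast
qed

text \<open>Induction on the index set: the map found for \<open>I\<close> is followed by one
  reflection that corrects the image of the new vector. No basis is chosen, so the vectors may be
  linearly dependent.\<close>

lemma orthogonal_transformation_of_gram:
  fixes a b :: "'i \<Rightarrow> 'a::euclidean_space"
  assumes "finite I" and "\<And>i j. i \<in> I \<Longrightarrow> j \<in> I \<Longrightarrow> a i \<bullet> a j = b i \<bullet> b j"
  shows "\<exists>T. orthogonal_transformation T \<and> (\<forall>i\<in>I. T (a i) = b i)"
  using assms
proof (induction I rule: finite_induct)
  case empty
  show ?case using orthogonal_transformation_id by blast
next
  case (insert k I)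
  then obtain T where T: "orthogonal_transformation T" "\<forall>i\<in>I. T (a i) = b i"
    by auto
  \<comment> \<open>The reflection exchanging \<open>T (a k)\<close> and \<open>b k\<close> fixes every \<open>b i\<close> with \<open>i \<in> I\<close>.\<close>
  define n where "n = T (a k) - b k"
  define h where "h x = x - (2 * (x \<bullet> n) / (n \<bullet> n)) *\<^sub>R n" for x
  have h: "orthogonal_transformation h"
    using orthogonal_transformation_reflection[of n] by (simp add: h_def[abs_def])
  have "h (b i) = b i" if "i \<in> I" for i
  proof -
    have "b i \<bullet> T (a k) = a i \<bullet> a k"
      using T that unfolding orthogonal_transformation_def by metis
    also have "\<dots> = b i \<bullet> b k" using insert.prems that by auto
    finally have "b i \<bullet> n = 0" by (simp add: n_def inner_simps)
    then show ?thesis by (simp add: h_def)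
  qed
  moreover have "h (T (a k)) = b k"
  proof (cases "n = 0")
    case True
    then show ?thesis by (simp add: h_def n_def)
  next
    case False
    have "T (a k) \<bullet> T (a k) = b k \<bullet> b k"
      using T(1) insert.prems[of k k] unfolding orthogonal_transformation_def by auto
    \<comment> \<open>Equal lengths make the coefficient in \<open>h\<close> equal to 1 at
      \<open>T (a k)\<close>, so \<open>h\<close> subtracts exactly \<open>n\<close>.\<close>
    then have "2 * (T (a k) \<bullet> n) = n \<bullet> n"
      by (simp add: n_def inner_simps inner_commute)
    then show ?thesis using False by (simp add: h_def n_def)
  qed
  ultimately have "\<forall>i\<in>insert k I. (h \<circ> T) (a i) = b i" using T(2) by auto
  moreover have "orthogonal_transformation (h \<circ> T)"
    using h T(1) by (rule orthogonal_transformation_compose)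
  ultimately show ?case by blast
qed

text \<open>Expanding the squares, the cross terms collect into the inner product of
  \<open>x\<close> with the weighted sum, which vanishes. Distances thus give squared norms up to a
  constant common to all points.\<close>

lemma inner_self_of_centered:
  fixes a :: "'i \<Rightarrow> 'a::real_inner"
  assumes "(\<Sum>j\<in>I. m j *\<^sub>R a j) = 0"
  shows "(\<Sum>j\<in>I. m j * (dist x (a j))\<^sup>2) = sum m I * (x \<bullet> x) + (\<Sum>j\<in>I. m j * (a j \<bullet> a j))"
proof -
  have "(\<Sum>j\<in>I. m j * (dist x (a j))\<^sup>2)
      = (\<Sum>j\<in>I. m j * (x \<bullet> x) + m j * (a j \<bullet> a j) - 2 * (x \<bullet> (m j *\<^sub>R a j)))"
    by (rule sum.cong)
      (auto simp: dist_norm power2_norm_eq_inner inner_simps inner_commute algebra_simps)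
  also have "\<dots> = sum m I * (x \<bullet> x) + (\<Sum>j\<in>I. m j * (a j \<bullet> a j))
      - 2 * (x \<bullet> (\<Sum>j\<in>I. m j *\<^sub>R a j))"
    by (simp add: sum.distrib sum_subtractf sum_distrib_right sum_distrib_left inner_sum_right)
  finally show ?thesis using assms by simp
qed

lemma gram_of_centered_distances:
  fixes a b :: "'i \<Rightarrow> 'a::real_inner"
  assumes "sum m I \<noteq> 0"
    and "(\<Sum>j\<in>I. m j *\<^sub>R a j) = 0" "(\<Sum>j\<in>I. m j *\<^sub>R b j) = 0"
    and d: "\<And>i j. i \<in> I \<Longrightarrow> j \<in> I \<Longrightarrow> dist (a i) (a j) = dist (b i) (b j)"
    and "i \<in> I" "j \<in> I"
  shows "a i \<bullet> a j = b i \<bullet> b j"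
proof -
  define M where "M = sum m I"
  define A where "A = (\<Sum>j\<in>I. m j * (a j \<bullet> a j))"
  define B where "B = (\<Sum>j\<in>I. m j * (b j \<bullet> b j))"
  have *: "M * (a i \<bullet> a i) + A = M * (b i \<bullet> b i) + B" if "i \<in> I" for i
    using inner_self_of_centered[OF assms(2), of "a i"]
      inner_self_of_centered[OF assms(3), of "b i"] d[OF that]
    by (simp add: M_def A_def B_def)
  have lin: "(\<Sum>i\<in>I. m i * (M * x i + C)) = M * (\<Sum>i\<in>I. m i * x i) + M * C" for x C
  proof -
    have "(\<Sum>i\<in>I. m i * (M * x i + C)) = (\<Sum>i\<in>I. M * (m i * x i) + m i * C)"
      by (rule sum.cong) (auto simp: algebra_simps)
    then show ?thesis
      by (simp only: sum.distrib sum_distrib_left[symmetric] sum_distrib_right[symmetric] M_def)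
  qed
  \<comment> \<open>Averaging \<open>*\<close> with the weights \<open>m i\<close> reproduces
    \<open>A\<close> and \<open>B\<close> themselves, which forces the unknown constants to agree.
    The mixed inner products then follow by polarization.\<close>
  have "(\<Sum>i\<in>I. m i * (M * (a i \<bullet> a i) + A)) = (\<Sum>i\<in>I. m i * (M * (b i \<bullet> b i) + B))"
    using * by (intro sum.cong) auto
  then have "M * A + M * A = M * B + M * B" unfolding lin A_def B_def .
  then have "A = B" using assms(1) by (simp add: M_def)
  then have sq: "a i \<bullet> a i = b i \<bullet> b i" if "i \<in> I" for i
    using *[OF that] assms(1) by (simp add: M_def)
  have "(dist (a i) (a j))\<^sup>2 = (dist (b i) (b j))\<^sup>2" using d assms by simp
  then show ?thesis
    using sq assms by (simp add: dist_norm power2_norm_eq_inner inner_simps inner_commute)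
qed

section \<open>Convexity in logarithmic variables and uniqueness of the minimizer\<close>

text \<open>With \<open>x = ln s\<close> the function is \<open>exp (- x) + exp (2 * x) / 2\<close>,
  whose derivative at \<open>ln t\<close> is \<open>t^2 - 1/t\<close>: a convex function lies above
  its tangent. Each exponential is handled by \<open>ln y <= y - 1\<close>; strictness is taken from
  the term \<open>1/s\<close>.\<close>

lemma potential_tangent:
  fixes s t :: real
  assumes "s > 0" "t > 0"
  shows "1/s + s\<^sup>2/2 \<ge> 1/t + t\<^sup>2/2 + (t\<^sup>2 - 1/t) * (ln s - ln t)"
    and "s \<noteq> t \<Longrightarrow> 1/s + s\<^sup>2/2 > 1/t + t\<^sup>2/2 + (t\<^sup>2 - 1/t) * (ln s - ln t)"
proof -
  have u: "ln (t/s) \<le> t/s - 1"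
    using assms by (intro ln_le_minus_one) auto
  have v: "ln (s\<^sup>2/t\<^sup>2) \<le> s\<^sup>2/t\<^sup>2 - 1"
    using assms by (intro ln_le_minus_one) auto
  have lu: "ln (t/s) = - (ln s - ln t)" and lv: "ln (s\<^sup>2/t\<^sup>2) = 2 * (ln s - ln t)"
    using assms by (simp_all add: ln_div ln_realpow)
  have 2: "s\<^sup>2/2 \<ge> t\<^sup>2/2 + t\<^sup>2 * (ln s - ln t)"
    using mult_left_mono[OF v, of "t\<^sup>2"] assms by (simp add: lv right_diff_distrib)
  have e: "1/t * (t/s - 1) = 1/s - 1/t" using assms by (simp add: field_simps)
  have "1/t * ln (t/s) \<le> 1/t * (t/s - 1)"
    using u assms by (intro mult_left_mono) auto
  then show "1/s + s\<^sup>2/2 \<ge> 1/t + t\<^sup>2/2 + (t\<^sup>2 - 1/t) * (ln s - ln t)"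
    using 2 unfolding e lu by (simp add: algebra_simps)
  assume "s \<noteq> t"
  then have "ln (t/s) < t/s - 1"
    using u ln_eq_minus_one[of "t/s"] assms by fastforce
  then have "1/t * ln (t/s) < 1/t * (t/s - 1)"
    using assms by (intro mult_strict_left_mono) auto
  then show "1/s + s\<^sup>2/2 > 1/t + t\<^sup>2/2 + (t\<^sup>2 - 1/t) * (ln s - ln t)"
    using 2 unfolding e lu by (simp add: algebra_simps)
qed

text \<open>This is the tangent inequality for \<open>ln (exp x + exp y)\<close>, whose gradient is
  \<open>(P, Q) / (P + Q)\<close> at \<open>x = ln P\<close>, \<open>y = ln Q\<close>.\<close>

lemma log_sum_inequality:
  fixes P Q P' Q' :: real
  assumes "P > 0" "Q > 0" "P' > 0" "Q' > 0"
  shows "P * (ln P' - ln P) + Q * (ln Q' - ln Q) \<le> (P + Q) * (ln (P' + Q') - ln (P + Q))"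
proof -
  have *: "X * (ln X' - ln X - (ln (P' + Q') - ln (P + Q))) \<le> X' * (P + Q) / (P' + Q') - X"
    if "X > 0" "X' > 0" for X X'
  proof -
    have "ln (X' * (P + Q) / (X * (P' + Q'))) \<le> X' * (P + Q) / (X * (P' + Q')) - 1"
      using assms that by (intro ln_le_minus_one) auto
    moreover have "ln (X' * (P + Q) / (X * (P' + Q'))) = ln X' - ln X - (ln (P' + Q') - ln (P + Q))"
      using assms that by (simp add: ln_div ln_mult)
    ultimately have "X * (ln X' - ln X - (ln (P' + Q') - ln (P + Q)))
        \<le> X * (X' * (P + Q) / (X * (P' + Q')) - 1)"
      using that by (intro mult_left_mono) auto
    also have "\<dots> = X' * (P + Q) / (P' + Q') - X"
      using that assms by (simp add: right_diff_distrib)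
    finally show ?thesis .
  qed
  \<comment> \<open>Hence the upper bounds of \<open>*\<close> for \<open>P, P'\<close> and for
    \<open>Q, Q'\<close> add up to zero.\<close>
  have "P' * (P + Q) / (P' + Q') + Q' * (P + Q) / (P' + Q') = P + Q"
    using assms by (simp flip: add_divide_distrib distrib_right)
  then show ?thesis
    using *[of P P'] *[of Q Q'] assms by (simp add: algebra_simps)
qed

text \<open>The stationarity equations in \<open>ln t\<^sub>i\<^sub>j\<close>, with \<open>s\<close> the multiplier of Ptolemy's relation;
  the multiplier of the moment of inertia is normalized to 1 by scaling. Only the values
  \<open>t i j\<close> with \<open>i < j < 4\<close> matter.\<close>

definition dziobek :: "(nat \<Rightarrow> real) \<Rightarrow> (nat \<Rightarrow> nat \<Rightarrow> real) \<Rightarrow> real \<Rightarrow> bool" where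
  "dziobek m t s \<longleftrightarrow>
     0 < t 0 1 \<and> 0 < t 0 2 \<and> 0 < t 0 3 \<and> 0 < t 1 2 \<and> 0 < t 1 3 \<and> 0 < t 2 3 \<and>
     t 0 2 * t 1 3 = t 0 1 * t 2 3 + t 0 3 * t 1 2 \<and>
     m 0 * m 1 * (1 / t 0 1 - (t 0 1)\<^sup>2) = s * (t 0 1 * t 2 3) \<and>
     m 2 * m 3 * (1 / t 2 3 - (t 2 3)\<^sup>2) = s * (t 0 1 * t 2 3) \<and>
     m 0 * m 3 * (1 / t 0 3 - (t 0 3)\<^sup>2) = s * (t 0 3 * t 1 2) \<and>
     m 1 * m 2 * (1 / t 1 2 - (t 1 2)\<^sup>2) = s * (t 0 3 * t 1 2) \<and>
     m 0 * m 2 * (1 / t 0 2 - (t 0 2)\<^sup>2) = - s * (t 0 2 * t 1 3) \<and>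
     m 1 * m 3 * (1 / t 1 3 - (t 1 3)\<^sup>2) = - s * (t 0 2 * t 1 3)"

lemma inverse_minus_square_sign:
  fixes t :: real
  assumes "t > 0"
  shows "1/t - t\<^sup>2 > 0 \<longleftrightarrow> t < 1" "1/t - t\<^sup>2 < 0 \<longleftrightarrow> t > 1"
proof -
  have e: "t * (1/t - t\<^sup>2) = 1 - t^3"
    using assms by (simp add: field_simps power2_eq_square power3_eq_cube)
  have "1/t - t\<^sup>2 > 0 \<longleftrightarrow> 1 - t^3 > 0" "1/t - t\<^sup>2 < 0 \<longleftrightarrow> 1 - t^3 < 0"
    unfolding e[symmetric] using assms by (simp_all add: zero_less_mult_iff mult_less_0_iff)
  then show "1/t - t\<^sup>2 > 0 \<longleftrightarrow> t < 1" "1/t - t\<^sup>2 < 0 \<longleftrightarrow> t > 1"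
    using assms power_less_one_iff[of t 3] one_less_power[of t 3] power_le_one[of t 3]
    by (auto simp: not_less[symmetric])
qed

lemma dziobek_multiplier_pos:
  assumes m: "\<forall>i<4. m i > 0" and D: "dziobek m t s"
  shows "s > 0"
proof (rule ccontr)
  \<comment> \<open>Otherwise all sides are at least 1 and both diagonals at most 1, against Ptolemy's relation.\<close>
  assume s: "\<not> s > 0"
  note D = D[unfolded dziobek_def]
  have ge1: "x \<ge> 1" if "x > 0" "k > 0" "k * (1/x - x\<^sup>2) = s * y" "y > 0" for x y k :: real
  proof -
    have "k * (1/x - x\<^sup>2) \<le> 0" using s that by (simp add: mult_nonpos_nonneg)
    then have "\<not> 1/x - x\<^sup>2 > 0" using that(2) by (simp add: mult_le_0_iff)
    then show ?thesis using inverse_minus_square_sign(1)[OF that(1)] by simp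
  qed
  have le1: "x \<le> 1" if "x > 0" "k > 0" "k * (1/x - x\<^sup>2) = - s * y" "y > 0" for x y k :: real
  proof -
    have "k * (1/x - x\<^sup>2) \<ge> 0" using s that by (simp add: mult_nonpos_nonneg)
    then have "\<not> 1/x - x\<^sup>2 < 0" using that(2) by (simp add: zero_le_mult_iff)
    then show ?thesis using inverse_minus_square_sign(2)[OF that(1)] by simp
  qed
  have mm: "m 0 > 0" "m 1 > 0" "m 2 > 0" "m 3 > 0" using m by auto
  have "t 0 1 \<ge> 1" using ge1[of "t 0 1" "m 0 * m 1"] D mm by (meson mult_pos_pos)
  moreover have "t 2 3 \<ge> 1" using ge1[of "t 2 3" "m 2 * m 3"] D mm by (meson mult_pos_pos)
  moreover have "t 0 3 \<ge> 1" using ge1[of "t 0 3" "m 0 * m 3"] D mm by (meson mult_pos_pos)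
  moreover have "t 1 2 \<ge> 1" using ge1[of "t 1 2" "m 1 * m 2"] D mm by (meson mult_pos_pos)
  moreover have "t 0 2 \<le> 1" using le1[of "t 0 2" "m 0 * m 2"] D mm by (meson mult_pos_pos)
  moreover have "t 1 3 \<le> 1" using le1[of "t 1 3" "m 1 * m 3"] D mm by (meson mult_pos_pos)
  moreover have "t 0 2 > 0" "t 1 3 > 0" using D by blast+
  ultimately have "1 \<le> t 0 1 * t 2 3" "1 \<le> t 0 3 * t 1 2" "t 0 2 * t 1 3 \<le> 1"
    using mult_mono[of 1 "t 0 1" 1 "t 2 3"] mult_mono[of 1 "t 0 3" 1 "t 1 2"]
      mult_mono[of "t 0 2" 1 "t 1 3" 1] by simp_all
  then show False using D by linarith
qed

text \<open>The pairs are listed as opposite sides, opposite sides, diagonals, matching the three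
  products in Ptolemy's relation. For a centered configuration of total mass \<open>M\<close> the
  quadratic part is \<open>M/2\<close> times the moment of inertia.\<close>

definition augmented_potential :: "(nat \<Rightarrow> real) \<Rightarrow> (nat \<Rightarrow> nat \<Rightarrow> real) \<Rightarrow> real" where
  "augmented_potential m t = (\<Sum>(i,j)\<in>{(0,1),(2,3),(0,3),(1,2),(0,2),(1,3)}.
     m i * m j * (1 / t i j + (t i j)\<^sup>2 / 2))"

text \<open>Linearize the potential at \<open>t\<close> in the logarithms of the distances.
  Stationarity turns the linear part into \<open>s\<close> times the gap in the log sum inequality,
  which is nonnegative because \<open>s > 0\<close>; convexity of each summand does the
  rest.\<close>

lemma dziobek_minimizes_potential:
  fixes t t' :: "nat \<Rightarrow> nat \<Rightarrow> real"
  assumes m: "\<forall>i<4. m i > 0" and D: "dziobek m t s" and D': "dziobek m t' s'"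
  shows "augmented_potential m t \<le> augmented_potential m t'"
    and "\<exists>i<4. \<exists>j<4. i < j \<and> t i j \<noteq> t' i j \<Longrightarrow> augmented_potential m t < augmented_potential m t'"
proof -
  let ?E = "{(0,1),(2,3),(0,3),(1,2),(0,2),(1,3)} :: (nat \<times> nat) set"
  \<comment> \<open>\<open>?f\<close> is the tangent approximation at \<open>t\<close>, evaluated at
    \<open>t'\<close>; \<open>?g\<close> is the true summand at \<open>t'\<close>.\<close>
  let ?f = "\<lambda>(i,j). m i * m j * (1 / t i j + (t i j)\<^sup>2 / 2)
      + m i * m j * ((t i j)\<^sup>2 - 1 / t i j) * (ln (t' i j) - ln (t i j))"
  let ?g = "\<lambda>(i,j). m i * m j * (1 / t' i j + (t' i j)\<^sup>2 / 2)"
  note D = D[unfolded dziobek_def] and D' = D'[unfolded dziobek_def]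
  have s: "s > 0" using m assms(2) by (rule dziobek_multiplier_pos)
  have tpos: "t 0 1 > 0" "t 2 3 > 0" "t 0 3 > 0" "t 1 2 > 0" "t 0 2 > 0" "t 1 3 > 0"
    "t' 0 1 > 0" "t' 2 3 > 0" "t' 0 3 > 0" "t' 1 2 > 0" "t' 0 2 > 0" "t' 1 3 > 0"
    using D D' by blast+
  define P where "P = t 0 1 * t 2 3"
  define Q where "Q = t 0 3 * t 1 2"
  define P' where "P' = t' 0 1 * t' 2 3"
  define Q' where "Q' = t' 0 3 * t' 1 2"
  have pos: "P > 0" "Q > 0" "P' > 0" "Q' > 0"
    using tpos by (simp_all add: P_def Q_def P'_def Q'_def)
  have PQ: "t 0 2 * t 1 3 = P + Q" "t' 0 2 * t' 1 3 = P' + Q'"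
    using D D' by (auto simp: P_def Q_def P'_def Q'_def)
  have lnP: "ln P = ln (t 0 1) + ln (t 2 3)" "ln Q = ln (t 0 3) + ln (t 1 2)"
    "ln P' = ln (t' 0 1) + ln (t' 2 3)" "ln Q' = ln (t' 0 3) + ln (t' 1 2)"
    "ln (P + Q) = ln (t 0 2) + ln (t 1 3)" "ln (P' + Q') = ln (t' 0 2) + ln (t' 1 3)"
    unfolding PQ[symmetric] unfolding P_def Q_def P'_def Q'_def
    by (rule ln_mult_pos[OF tpos(1,2)] ln_mult_pos[OF tpos(3,4)] ln_mult_pos[OF tpos(5,6)]
        ln_mult_pos[OF tpos(7,8)] ln_mult_pos[OF tpos(9,10)] ln_mult_pos[OF tpos(11,12)])+
  have neg: "k * (x\<^sup>2 - 1/x) = - y" if "k * (1/x - x\<^sup>2) = y" for k x y :: real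
    using that by (auto simp: algebra_simps)
  have co: "m 0 * m 1 * ((t 0 1)\<^sup>2 - 1 / t 0 1) = - (s * P)"
    "m 2 * m 3 * ((t 2 3)\<^sup>2 - 1 / t 2 3) = - (s * P)"
    "m 0 * m 3 * ((t 0 3)\<^sup>2 - 1 / t 0 3) = - (s * Q)"
    "m 1 * m 2 * ((t 1 2)\<^sup>2 - 1 / t 1 2) = - (s * Q)"
    "m 0 * m 2 * ((t 0 2)\<^sup>2 - 1 / t 0 2) = s * (P + Q)"
    "m 1 * m 3 * ((t 1 3)\<^sup>2 - 1 / t 1 3) = s * (P + Q)"
    unfolding PQ(1)[symmetric] P_def Q_def using D by (auto dest: neg)
  \<comment> \<open>By \<open>co\<close>, opposite edges have the same tangent coefficient, so their
    logarithms merge into those of \<open>P\<close>, \<open>Q\<close> and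
    \<open>P + Q\<close>.\<close>
  have "sum ?f ?E = augmented_potential m t + s * ((P + Q) * (ln (P' + Q') - ln (P + Q))
      - (P * (ln P' - ln P) + Q * (ln Q' - ln Q)))"
    unfolding augmented_potential_def by (simp add: co lnP del: One_nat_def) (simp add: algebra_simps del: One_nat_def)
  moreover have "s * ((P + Q) * (ln (P' + Q') - ln (P + Q))
      - (P * (ln P' - ln P) + Q * (ln Q' - ln Q))) \<ge> 0"
    using s log_sum_inequality[OF pos] by simp
  ultimately have le: "augmented_potential m t \<le> sum ?f ?E" by simp
  have pos_t: "\<forall>(i,j)\<in>?E. t i j > 0 \<and> t' i j > 0 \<and> m i * m j > 0"
    using tpos m by auto
  have f: "?f (i,j) = m i * m j * (1 / t i j + (t i j)\<^sup>2 / 2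
      + ((t i j)\<^sup>2 - 1 / t i j) * (ln (t' i j) - ln (t i j)))" for i j
    by (simp add: distrib_left mult.assoc)
  have fg: "?f e \<le> ?g e" if "e \<in> ?E" for e
  proof -
    obtain i j where e: "e = (i,j)" by (cases e)
    have p: "t i j > 0" "t' i j > 0" "m i * m j > 0" using pos_t that e by blast+
    show ?thesis unfolding e f using p potential_tangent(1)[of "t' i j" "t i j"]
      by (simp only: prod.case) (intro mult_left_mono, auto)
  qed
  have "sum ?f ?E \<le> sum ?g ?E" using fg by (rule sum_mono)
  then show "augmented_potential m t \<le> augmented_potential m t'"
    using le unfolding augmented_potential_def by simp
  assume "\<exists>i<4. \<exists>j<4. i < j \<and> t i j \<noteq> t' i j"
  then obtain i j :: nat where ij: "j < 4" "i < j" "t i j \<noteq> t' i j" by blast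
  then have "(j = 1 \<or> j = 2 \<or> j = 3) \<and> (i = 0 \<or> i = 1 \<or> i = 2)" by linarith
  then have E: "(i,j) \<in> ?E" using ij(2) by auto
  then have p: "t i j > 0" "t' i j > 0" "m i * m j > 0" using pos_t by blast+
  have "?f (i,j) < ?g (i,j)"
    unfolding f using p ij(3) potential_tangent(2)[of "t' i j" "t i j"]
    by (simp only: prod.case) (intro mult_strict_left_mono, auto)
  then have "sum ?f ?E < sum ?g ?E" using fg E by (intro sum_strict_mono_ex1) blast+
  then show "augmented_potential m t < augmented_potential m t'"
    using le unfolding augmented_potential_def by simp
qed

text \<open>Each solution has potential at most that of the other, yet any difference would make one
  comparison strict.\<close>

lemma dziobek_unique:
  assumes "\<forall>i<4. m i > 0" "dziobek m t s" "dziobek m t' s'" "i < j" "j < 4"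
  shows "t i j = t' i j"
proof (rule ccontr)
  assume "t i j \<noteq> t' i j"
  then have "\<exists>i<4. \<exists>j<4. i < j \<and> t i j \<noteq> t' i j" using assms(4,5) less_trans by blast
  then have "augmented_potential m t < augmented_potential m t'"
    by (rule dziobek_minimizes_potential(2)[OF assms(1-3)])
  then show False using dziobek_minimizes_potential(1)[OF assms(1,3,2)] by simp
qed

section \<open>From co-circular central configurations to the stationarity equations\<close>

text \<open>Since the center of mass is 0, \<open>M * q i\<close> is minus the weighted sum of the
  differences \<open>q j - q i\<close>. So the term with \<open>lam\<close> can be absorbed into the
  pair forces, with \<open>L = - lam / M\<close>.\<close>

lemma central_config_balance:
  fixes q :: "nat \<Rightarrow> real^'d"
  assumes m: "\<forall>i<4. m i > 0" and cc: "central_config m q"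
  obtains L where "\<And>i. i < 4 \<Longrightarrow>
    (\<Sum>j<4. (m i * m j * (1 / dist (q i) (q j) ^ 3 - L)) *\<^sub>R (q j - q i)) = 0"
proof -
  obtain lam where lam: "\<And>i. i < 4 \<Longrightarrow> (lam * m i) *\<^sub>R q i =
        (\<Sum>j\<in>{..<4} - {i}. (m i * m j / (dist (q i) (q j)) ^ 3) *\<^sub>R (q j - q i))"
    and c: "(\<Sum>i<4. m i *\<^sub>R q i) = 0"
    using cc unfolding central_config_def by blast
  define M where "M = (\<Sum>i<4. m i)"
  have M: "M > 0" unfolding M_def using m by (intro sum_pos) (auto simp: lessThan_empty_iff)
  have "(\<Sum>j<4. (m i * m j * (1 / dist (q i) (q j) ^ 3 - - lam / M)) *\<^sub>R (q j - q i)) = 0"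
    if i: "i < 4" for i
  proof -
    have "(\<Sum>j<4. (m i * m j * (1 / dist (q i) (q j) ^ 3 - - lam / M)) *\<^sub>R (q j - q i))
        = (\<Sum>j<4. (m i * m j / dist (q i) (q j) ^ 3) *\<^sub>R (q j - q i)
            + ((lam * m i / M) *\<^sub>R (m j *\<^sub>R q j) - (lam * m i / M) *\<^sub>R (m j *\<^sub>R q i)))"
      by (rule sum.cong) (auto simp: algebra_simps)
    also have "\<dots> = (\<Sum>j<4. (m i * m j / dist (q i) (q j) ^ 3) *\<^sub>R (q j - q i))
        + ((lam * m i / M) *\<^sub>R (\<Sum>j<4. m j *\<^sub>R q j) - (lam * m i / M) *\<^sub>R (M *\<^sub>R q i))"
      unfolding M_def
      by (simp only: sum.distrib sum_subtractf scaleR_sum_right[symmetric] scaleR_sum_left[symmetric])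
    \<comment> \<open>The extra term \<open>j = i\<close> has zero displacement, whatever the value
      of its coefficient.\<close>
    also have "(\<Sum>j<4. (m i * m j / dist (q i) (q j) ^ 3) *\<^sub>R (q j - q i)) = (lam * m i) *\<^sub>R q i"
      unfolding lam[OF i] using i by (subst sum.remove[of _ i]) auto
    finally show ?thesis using M c by simp
  qed
  then show thesis by (rule that)
qed

lemma dist_circle:
  fixes c u v :: "'a::real_inner"
  assumes "r > 0" "u \<bullet> u = 1" "v \<bullet> v = 1" "u \<bullet> v = 0"
  shows "dist (c + r *\<^sub>R (cos \<alpha> *\<^sub>R u + sin \<alpha> *\<^sub>R v)) (c + r *\<^sub>R (cos \<beta> *\<^sub>R u + sin \<beta> *\<^sub>R v))
    = 2 * r * \<bar>sin (\<beta>/2 - \<alpha>/2)\<bar>"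
proof -
  have 1: "cos \<alpha> - cos \<beta> = 2 * sin (\<alpha>/2 + \<beta>/2) * sin (\<beta>/2 - \<alpha>/2)"
    by (simp add: cos_diff_cos add_divide_distrib diff_divide_distrib)
  have 2: "sin \<alpha> - sin \<beta> = - (2 * cos (\<alpha>/2 + \<beta>/2) * sin (\<beta>/2 - \<alpha>/2))"
    by (simp add: sin_diff_sin add_divide_distrib diff_divide_distrib)
       (metis minus_diff_eq mult_minus_right sin_minus mult.commute mult.left_commute)
  have pyth: "(norm (x *\<^sub>R u + y *\<^sub>R v))\<^sup>2 = x\<^sup>2 + y\<^sup>2" for x y
    unfolding power2_norm_eq_inner using assms
    by (simp add: inner_simps inner_commute[of v u] power2_eq_square)
  have "(c + r *\<^sub>R (cos \<alpha> *\<^sub>R u + sin \<alpha> *\<^sub>R v)) - (c + r *\<^sub>R (cos \<beta> *\<^sub>R u + sin \<beta> *\<^sub>R v))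
     = (r * (cos \<alpha> - cos \<beta>)) *\<^sub>R u + (r * (sin \<alpha> - sin \<beta>)) *\<^sub>R v"
    by (simp add: algebra_simps)
  then have "(dist (c + r *\<^sub>R (cos \<alpha> *\<^sub>R u + sin \<alpha> *\<^sub>R v)) (c + r *\<^sub>R (cos \<beta> *\<^sub>R u + sin \<beta> *\<^sub>R v)))\<^sup>2
     = (r * (cos \<alpha> - cos \<beta>))\<^sup>2 + (r * (sin \<alpha> - sin \<beta>))\<^sup>2"
    by (simp only: dist_norm pyth)
  also have "\<dots> = (2 * r * sin (\<beta>/2 - \<alpha>/2))\<^sup>2 * ((sin (\<alpha>/2 + \<beta>/2))\<^sup>2 + (cos (\<alpha>/2 + \<beta>/2))\<^sup>2)"
    unfolding 1 2 by algebra
  also have "\<dots> = (2 * r * \<bar>sin (\<beta>/2 - \<alpha>/2)\<bar>)\<^sup>2" by (simp add: power_mult_distrib)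
  finally show ?thesis using assms(1) by (simp add: power2_eq_iff_nonneg)
qed

text \<open>The test vector at angle \<open>k + a\<close> is normal to the chord joining the points
  at angles \<open>2*a\<close> and \<open>2*k\<close>. Pairing a force balance with it therefore
  eliminates the body at \<open>2*k\<close>.\<close>

lemma chord_inner_circle:
  fixes c u v :: "'a::real_inner"
  assumes "u \<bullet> u = 1" "v \<bullet> v = 1" "u \<bullet> v = 0"
  shows "((c + r *\<^sub>R (cos (2*b) *\<^sub>R u + sin (2*b) *\<^sub>R v)) - (c + r *\<^sub>R (cos (2*a) *\<^sub>R u + sin (2*a) *\<^sub>R v)))
      \<bullet> (cos (k + a) *\<^sub>R u + sin (k + a) *\<^sub>R v) = - (2 * r) * (sin (b - a) * sin (b - k))"
proof -
  have 1: "cos (2*b) - cos (2*a) = - (2 * sin (b + a) * sin (b - a))"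
    using cos_diff_cos[of "2*b" "2*a"] sin_minus[of "b - a"]
    by (simp add: add_divide_distrib diff_divide_distrib)
  have 2: "sin (2*b) - sin (2*a) = 2 * cos (b + a) * sin (b - a)"
    using sin_diff_sin[of "2*b" "2*a"] by (simp add: add_divide_distrib diff_divide_distrib)
  have 3: "sin (b - k) = sin (b + a) * cos (k + a) - cos (b + a) * sin (k + a)"
    using sin_diff[of "b + a" "k + a"] by simp
  have "((c + r *\<^sub>R (cos (2*b) *\<^sub>R u + sin (2*b) *\<^sub>R v)) - (c + r *\<^sub>R (cos (2*a) *\<^sub>R u + sin (2*a) *\<^sub>R v)))
      \<bullet> (cos (k + a) *\<^sub>R u + sin (k + a) *\<^sub>R v)
      = r * ((cos (2*b) - cos (2*a)) * cos (k + a) + (sin (2*b) - sin (2*a)) * sin (k + a))"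
    using assms by (simp add: inner_simps inner_commute[of v u] algebra_simps)
  also have "\<dots> = - (2 * r) * (sin (b - a) * sin (b - k))"
    unfolding 1 2 3 by algebra
  finally show ?thesis .
qed

text \<open>For distinct \<open>i\<close> and \<open>k\<close> the terms \<open>j = i\<close> and
  \<open>j = k\<close> of \<open>bal\<close> vanish, leaving a relation between two weights. Five
  such relations express every weight through \<open>w 0 1\<close>, and \<open>s\<close> is defined
  from that one.\<close>

lemma sine_balance_ratios:
  fixes w :: "nat \<Rightarrow> nat \<Rightarrow> real" and a :: "nat \<Rightarrow> real"
  defines "S \<equiv> \<lambda>i j. sin (a j - a i)"
  assumes bal: "\<And>i k. i < 4 \<Longrightarrow> k < 4 \<Longrightarrow> (\<Sum>j<4. w i j * (S i j * S k j)) = 0"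
    and sym: "\<And>i j. w i j = w j i"
    and pos: "\<And>i j. i < j \<Longrightarrow> j < 4 \<Longrightarrow> S i j > 0"
  obtains s where "w 0 1 * S 0 1 = s * S 2 3" "w 2 3 * S 2 3 = s * S 0 1"
    "w 0 3 * S 0 3 = s * S 1 2" "w 1 2 * S 1 2 = s * S 0 3"
    "w 0 2 * S 0 2 = - s * S 1 3" "w 1 3 * S 1 3 = - s * S 0 2"
proof -
  have anti: "S 1 0 = - S 0 1" "S 2 0 = - S 0 2" "S 3 0 = - S 0 3"
    "S 2 1 = - S 1 2" "S 3 1 = - S 1 3" "S 3 2 = - S 2 3" and diag: "S i i = 0" for i
    unfolding S_def by (simp_all flip: sin_minus)
  have p: "S 0 1 \<noteq> 0" "S 0 2 \<noteq> 0" "S 0 3 \<noteq> 0" "S 1 2 \<noteq> 0" "S 1 3 \<noteq> 0" "S 2 3 \<noteq> 0"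
    using pos[of 0 1] pos[of 0 2] pos[of 0 3] pos[of 1 2] pos[of 1 3] pos[of 2 3] by auto
  have four: "(\<Sum>j<4. f j) = f 0 + f 1 + f 2 + f (3::nat)" for f :: "nat \<Rightarrow> real"
    by (simp add: eval_nat_numeral)
  define s where "s = w 0 1 * S 0 1 / S 2 3"
  have e1: "w 0 1 * S 0 1 = s * S 2 3" using p by (simp add: s_def)
  have b: "w 0 1 * S 0 1 * S 1 3 + w 0 2 * S 0 2 * S 2 3 = 0"
    "w 0 2 * S 0 2 * S 1 2 + w 0 3 * S 0 3 * S 1 3 = 0"
    "w 0 1 * S 0 1 * S 0 3 = w 1 2 * S 1 2 * S 2 3"
    "w 0 1 * S 0 1 * S 0 2 + w 1 3 * S 1 3 * S 2 3 = 0"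
    "w 0 2 * S 0 2 * S 0 1 + w 2 3 * S 2 3 * S 1 3 = 0"
    using bal[of 0 3] bal[of 0 1] bal[of 1 3] bal[of 1 2] bal[of 2 1]
    by (simp_all add: four anti diag sym[of 1 0] sym[of 2 0] add_eq_0_iff del: One_nat_def)
  have "(w 0 2 * S 0 2) * S 2 3 = (- s * S 1 3) * S 2 3"
    using b(1) unfolding e1 by (simp add: algebra_simps add_eq_0_iff)
  then have e2: "w 0 2 * S 0 2 = - s * S 1 3" unfolding mult_right_cancel[OF p(6)] .
  show thesis
  proof (rule that[OF e1 _ _ _ e2])
    have "(w 2 3 * S 2 3) * S 1 3 = (s * S 0 1) * S 1 3"
      using b(5) unfolding e2 by (simp add: algebra_simps)
    then show "w 2 3 * S 2 3 = s * S 0 1" unfolding mult_right_cancel[OF p(5)] .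
    have "(w 0 3 * S 0 3) * S 1 3 = (s * S 1 2) * S 1 3"
      using b(2) unfolding e2 by (simp add: algebra_simps)
    then show "w 0 3 * S 0 3 = s * S 1 2" unfolding mult_right_cancel[OF p(5)] .
    have "(w 1 2 * S 1 2) * S 2 3 = (s * S 0 3) * S 2 3"
      using b(3) unfolding e1 by (auto simp: algebra_simps)
    then show "w 1 2 * S 1 2 = s * S 0 3" unfolding mult_right_cancel[OF p(6)] .
    have "(w 1 3 * S 1 3) * S 2 3 = (- s * S 0 2) * S 2 3"
      using b(4) unfolding e1 by (simp add: algebra_simps add_eq_0_iff)
    then show "w 1 3 * S 1 3 = - s * S 0 2" unfolding mult_right_cancel[OF p(6)] .
  qed
qed

text \<open>Relabelling by \<open>\<sigma>\<close> puts the bodies in circular order 0, 1, 2, 3.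
  Pairing the balance equations with chord normals gives \<open>sine_balance_ratios\<close>, and the
  sines are the distances divided by \<open>2 * r\<close>.\<close>

lemma cocircular_central_config_dziobek:
  fixes q :: "nat \<Rightarrow> real^'d"
  assumes m: "\<forall>i<4. m i > 0" and perm: "\<sigma> permutes {..<4}"
    and cc: "central_config m q" and circ: "cocircular_with_order \<sigma> q"
  obtains k s where "k > 0" "dziobek (m \<circ> \<sigma>) (\<lambda>i j. k * dist (q (\<sigma> i)) (q (\<sigma> j))) s"
proof -
  have \<sigma>: "\<sigma> i < 4" if "i < 4" for i using permutes_in_image[OF perm, of i] that by simp
  obtain L where L: "\<And>i. i < 4 \<Longrightarrow>
    (\<Sum>j<4. (m i * m j * (1 / dist (q i) (q j) ^ 3 - L)) *\<^sub>R (q j - q i)) = 0"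
    using central_config_balance[OF m cc] by blast
  obtain c u v r \<theta> where r: "r > 0" and uv: "u \<bullet> u = 1" "v \<bullet> v = 1" "u \<bullet> v = 0"
    and q: "\<And>i. i < 4 \<Longrightarrow> q i = c + r *\<^sub>R (cos (\<theta> i) *\<^sub>R u + sin (\<theta> i) *\<^sub>R v)"
    and ord: "\<theta> (\<sigma> 0) < \<theta> (\<sigma> 1)" "\<theta> (\<sigma> 1) < \<theta> (\<sigma> 2)"
        "\<theta> (\<sigma> 2) < \<theta> (\<sigma> 3)" "\<theta> (\<sigma> 3) < \<theta> (\<sigma> 0) + 2 * pi"
    using circ unfolding cocircular_with_order_def by blast
  \<comment> \<open>Half angles: their differences for \<open>i < j\<close> lie strictly between 0
    and \<open>pi\<close>, so all the sines are positive.\<close>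
  define a where "a i = \<theta> (\<sigma> i) / 2" for i
  define \<mu> where "\<mu> = m \<circ> \<sigma>"
  define d where "d i j = dist (q (\<sigma> i)) (q (\<sigma> j))" for i j
  \<comment> \<open>On the diagonal \<open>w i i\<close> involves a division by zero, but it only
    ever multiplies a vanishing displacement or sine.\<close>
  define w where "w i j = \<mu> i * \<mu> j * (1 / d i j ^ 3 - L)" for i j
  have \<mu>: "\<mu> i > 0" if "i < 4" for i using m \<sigma> that by (simp add: \<mu>_def)
  have p: "q (\<sigma> i) = c + r *\<^sub>R (cos (2 * a i) *\<^sub>R u + sin (2 * a i) *\<^sub>R v)" if "i < 4" for i
    using q[OF \<sigma>[OF that]] by (simp add: a_def)
  have S: "sin (a j - a i) > 0" if "i < j" "j < 4" for i j
  proof (rule sin_gt_zero)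
    have "(j = 1 \<or> j = 2 \<or> j = 3) \<and> (i = 0 \<or> i = 1 \<or> i = 2)" using that by linarith
    then show "0 < a j - a i" "a j - a i < pi" using ord that by (auto simp: a_def)
  qed
  have d: "d i j = 2 * r * sin (a j - a i)" if "i < j" "j < 4" for i j
    unfolding d_def using dist_circle[OF r uv, of c "2 * a i" "2 * a j"] p[of i] p[of j] S[OF that] that
    by simp
  have bal: "(\<Sum>j<4. w i j * (sin (a j - a i) * sin (a j - a k))) = 0" if "i < 4" "k < 4" for i k
  proof -
    let ?n = "cos (a k + a i) *\<^sub>R u + sin (a k + a i) *\<^sub>R v"
    have "0 = (\<Sum>j<4. w i j *\<^sub>R (q (\<sigma> j) - q (\<sigma> i)))"
      using L[OF \<sigma>[OF that(1)]] sum.permute[OF perm,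
          of "\<lambda>j. (m (\<sigma> i) * m j * (1 / dist (q (\<sigma> i)) (q j) ^ 3 - L)) *\<^sub>R (q j - q (\<sigma> i))"]
      by (simp add: w_def \<mu>_def d_def o_def)
    then have "0 = (\<Sum>j<4. w i j *\<^sub>R (q (\<sigma> j) - q (\<sigma> i))) \<bullet> ?n" by (metis inner_zero_left)
    also have "\<dots> = (\<Sum>j<4. w i j * ((q (\<sigma> j) - q (\<sigma> i)) \<bullet> ?n))"
      by (simp only: inner_sum_left inner_scaleR_left)
    also have "\<dots> = (\<Sum>j<4. w i j * (- (2 * r) * (sin (a j - a i) * sin (a j - a k))))"
    proof (rule sum.cong[OF refl])
      fix j :: nat assume "j \<in> {..<4}"
      then have j: "j < 4" by simp
      show "w i j * ((q (\<sigma> j) - q (\<sigma> i)) \<bullet> ?n)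
          = w i j * (- (2 * r) * (sin (a j - a i) * sin (a j - a k)))"
        unfolding p[OF j] p[OF that(1)] chord_inner_circle[OF uv] ..
    qed
    also have "\<dots> = - (2 * r) * (\<Sum>j<4. w i j * (sin (a j - a i) * sin (a j - a k)))"
      unfolding sum_distrib_left by (rule sum.cong) auto
    finally show ?thesis using r by simp
  qed
  have sym: "w i j = w j i" for i j by (simp add: w_def d_def dist_commute mult.commute)
  obtain s where s': "w 0 1 * sin (a 1 - a 0) = s * sin (a 3 - a 2)"
    "w 2 3 * sin (a 3 - a 2) = s * sin (a 1 - a 0)"
    "w 0 3 * sin (a 3 - a 0) = s * sin (a 2 - a 1)"
    "w 1 2 * sin (a 2 - a 1) = s * sin (a 3 - a 0)"
    "w 0 2 * sin (a 2 - a 0) = - s * sin (a 3 - a 1)"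
    "w 1 3 * sin (a 3 - a 1) = - s * sin (a 2 - a 0)"
    using sine_balance_ratios[of w a, OF bal sym S] by blast
  have dd: "d 0 1 = 2 * r * sin (a 1 - a 0)" "d 0 2 = 2 * r * sin (a 2 - a 0)"
    "d 0 3 = 2 * r * sin (a 3 - a 0)" "d 1 2 = 2 * r * sin (a 2 - a 1)"
    "d 1 3 = 2 * r * sin (a 3 - a 1)" "d 2 3 = 2 * r * sin (a 3 - a 2)"
    by (simp_all add: d)
  have s: "w 0 1 * d 0 1 = s * d 2 3" "w 2 3 * d 2 3 = s * d 0 1"
    "w 0 3 * d 0 3 = s * d 1 2" "w 1 2 * d 1 2 = s * d 0 3"
    "w 0 2 * d 0 2 = - s * d 1 3" "w 1 3 * d 1 3 = - s * d 0 2"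
    unfolding dd using s' by (simp_all add: mult.left_commute[of _ "2 * r"])
  have dpos: "d 0 1 > 0" "d 0 2 > 0" "d 0 3 > 0" "d 1 2 > 0" "d 1 3 > 0" "d 2 3 > 0"
    unfolding dd using r S by simp_all
  have ptolemy: "d 0 2 * d 1 3 = d 0 1 * d 2 3 + d 0 3 * d 1 2"
  proof -
    \<comment> \<open>After \<open>sin_diff\<close> each factor is a 2 by 2 determinant, and this is
      the three-term Pluecker relation.\<close>
    have "sin (a 2 - a 0) * sin (a 3 - a 1)
        = sin (a 1 - a 0) * sin (a 3 - a 2) + sin (a 3 - a 0) * sin (a 2 - a 1)"
      unfolding sin_diff by algebra
    then show ?thesis unfolding dd by algebra
  qed
  have "L > 0"
  proof (rule ccontr)
    assume "\<not> L > 0"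
    \<comment> \<open>With \<open>L <= 0\<close> every weight is positive: then a side forces
      \<open>s > 0\<close> while a diagonal forces \<open>s < 0\<close>.\<close>
    then have w: "w i j > 0" if "d i j > 0" "i < 4" "j < 4" for i j
      using \<mu> that unfolding w_def diff_conv_add_uminus
      by (intro mult_pos_pos add_pos_nonneg) auto
    have "s * d 2 3 > 0" "- s * d 1 3 > 0"
      unfolding s(1,5)[symmetric] using w dpos by simp_all
    then show False using dpos by (simp add: zero_less_mult_iff mult_less_0_iff)
  qed
  \<comment> \<open>Multiplying distances by \<open>k\<close> turns \<open>1 / d^3 - L\<close> into
    \<open>L * (1 / (k * d)^3 - 1)\<close>, which normalizes the multiplier to 1.\<close>
  define k where "k = root 3 L"
  have k: "k > 0" and k3: "k ^ 3 = L" using \<open>L > 0\<close> by (simp_all add: k_def)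
  \<comment> \<open>Here \<open>x\<close> is the opposite edge: a further factor
    \<open>d i j\<close> produces the product of opposite edges demanded by
    \<open>dziobek\<close>.\<close>
  have scale: "\<mu> i * \<mu> j * (1 / (k * d i j) - (k * d i j)\<^sup>2) = (e / L) * ((k * d i j) * (k * x))"
    if "w i j * d i j = e * x" "d i j > 0" for i j e x
  proof -
    have "1 / (k * d i j) - (k * d i j)\<^sup>2 = k\<^sup>2 / L * ((1 / d i j ^ 3 - L) * d i j * d i j)"
      using that(2) k unfolding k3[symmetric]
      by (simp add: field_simps power2_eq_square power3_eq_cube)
    then have "\<mu> i * \<mu> j * (1 / (k * d i j) - (k * d i j)\<^sup>2) = k\<^sup>2 / L * (w i j * d i j) * d i j"
      by (simp add: w_def)
    also have "\<dots> = (e / L) * ((k * d i j) * (k * x))"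
      unfolding that(1) by (simp add: power2_eq_square)
    finally show ?thesis .
  qed
  have "dziobek \<mu> (\<lambda>i j. k * d i j) (s / L)"
    unfolding dziobek_def
    using k dpos ptolemy scale[OF s(1)] scale[OF s(2)] scale[OF s(3)] scale[OF s(4)] scale[OF s(5)] scale[OF s(6)]
    by (auto simp: algebra_simps)
  then show thesis using that k unfolding \<mu>_def d_def by blast
qed

theorem theorem1:
  fixes m :: "nat \<Rightarrow> real" and \<sigma> :: "nat \<Rightarrow> nat" and q q' :: "nat \<Rightarrow> real^'d"
  assumes "\<forall>i<4. m i > 0"
    and "\<sigma> permutes {..<4}"
    and "central_config m q" and "cocircular_with_order \<sigma> q"
    and "central_config m q'" and "cocircular_with_order \<sigma> q'"
  shows "equivalent_config q q'"
proof -
  obtain k s where k: "k > 0" "dziobek (m \<circ> \<sigma>) (\<lambda>i j. k * dist (q (\<sigma> i)) (q (\<sigma> j))) s"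
    using cocircular_central_config_dziobek[OF assms(1-4)] by blast
  obtain k' s' where k': "k' > 0" "dziobek (m \<circ> \<sigma>) (\<lambda>i j. k' * dist (q' (\<sigma> i)) (q' (\<sigma> j))) s'"
    using cocircular_central_config_dziobek[OF assms(1,2,5,6)] by blast
  have "\<forall>i<4. (m \<circ> \<sigma>) i > 0"
    using assms(1) permutes_in_image[OF assms(2)] by simp
  note eq = dziobek_unique[OF this k(2) k'(2)]
  have eq': "k * dist (q (\<sigma> i)) (q (\<sigma> j)) = k' * dist (q' (\<sigma> i)) (q' (\<sigma> j))" if "i < 4" "j < 4" for i j
    using eq[of i j] eq[of j i] that by (cases i j rule: linorder_cases) (auto simp: dist_commute)
  \<comment> \<open>The normalized distances agree, so the ratio of the two normalizing factors
    carries the distances of \<open>q\<close> to those of \<open>q'\<close>.\<close>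
  define \<kappa> where "\<kappa> = k / k'"
  have \<kappa>: "\<kappa> > 0" using k k' by (simp add: \<kappa>_def)
  have dist: "dist (\<kappa> *\<^sub>R q i) (\<kappa> *\<^sub>R q j) = dist (q' i) (q' j)" if ij: "i < 4" "j < 4" for i j
  proof -
    \<comment> \<open>Equality is known in the circular labelling; surjectivity of
      \<open>\<sigma>\<close> carries it back to the original labels.\<close>
    have "i \<in> \<sigma> ` {..<4}" "j \<in> \<sigma> ` {..<4}"
      unfolding permutes_image[OF assms(2)] using ij by simp_all
    then obtain i' j' where "i' < 4" "j' < 4" "i = \<sigma> i'" "j = \<sigma> j'" by auto
    then have "k * dist (q i) (q j) = k' * dist (q' i) (q' j)" using eq' by simp
    moreover have "dist (\<kappa> *\<^sub>R q i) (\<kappa> *\<^sub>R q j) = \<kappa> * dist (q i) (q j)"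
      using \<kappa> by (simp add: dist_norm flip: scaleR_diff_right)
    ultimately show ?thesis using k'(1) by (simp add: \<kappa>_def field_simps)
  qed
  have "(\<Sum>i<4. m i) > 0" using assms(1) by (intro sum_pos) (auto simp: lessThan_empty_iff)
  moreover have "(\<Sum>i<4. m i *\<^sub>R (\<kappa> *\<^sub>R q i)) = \<kappa> *\<^sub>R (\<Sum>i<4. m i *\<^sub>R q i)"
    by (simp add: scaleR_sum_right mult.commute)
  moreover have "(\<Sum>i<4. m i *\<^sub>R q i) = 0" "(\<Sum>i<4. m i *\<^sub>R q' i) = 0"
    using assms(3,5) by (auto simp: central_config_def)
  ultimately have "(\<kappa> *\<^sub>R q i) \<bullet> (\<kappa> *\<^sub>R q j) = q' i \<bullet> q' j" if "i \<in> {..<4}" "j \<in> {..<4}" for i j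
    using gram_of_centered_distances[of m "{..<4}" "\<lambda>i. \<kappa> *\<^sub>R q i" q' i j] dist that by auto
  then obtain T where T: "orthogonal_transformation T" "\<forall>i\<in>{..<4}. T (\<kappa> *\<^sub>R q i) = q' i"
    using orthogonal_transformation_of_gram[of "{..<4}" "\<lambda>i. \<kappa> *\<^sub>R q i" q'] by auto
  have lin: "linear T" using T(1) by (rule orthogonal_transformation_linear)
  have "q' i = \<kappa> *\<^sub>R (matrix T *v q i)" if "i < 4" for i
    using T(2) that lin by (simp add: matrix_works linear_cmul)
  moreover have "orthogonal_matrix (matrix T)"
    using T(1) by (simp add: orthogonal_transformation_matrix)
  ultimately show ?thesis
    unfolding equivalent_config_def using \<kappa>
    by (intro exI[of _ \<kappa>] exI[of _ "matrix T"]) auto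
qed

end
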